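(* Let $r \geq 3$ be an integer and let $n$ and $e$ be large quantities with $rn \ll e \ll n^2$. Then there exists a $K_r$-saturated graph $G$ with $|G| \asymp n$ and $e(G) \asymp e$ such that every vertex cover of $G$ has size $\Omega(\min(e/\log e, n))$. Explicitly: for all constants $a_1,a_2>0$ there exist constants $N_0$ and $b_1,\dots,b_5>0$ (depending only on $a_1,a_2$) such that for all integers $r\ge 3$ and all $n,e\ge N_0$ with $a_1 rn \le e \le a_2 n^2$ there is a $K_r$-saturated graph $G$ with $b_1 n\le |G|\le b_2 n$, $b_3 e\le e(G)\le b_4 e$, and every vertex cover of $G$ of size at least $b_5\min(e/\log e,n)$.
   Context: All graphs are finite and simple. A graph is $K_r$-saturated if it contains no copy of $K_r$ but adding any new edge creates a copy of $K_r$. $|G|$ is the number of vertices and $e(G)$ the number of edges. A vertex cover is a set of vertices meeting every edge. Notation: $f\ll g$ means $f\le Cg$ for a constant $C$; $f\asymp g$ means $f\ll g$ and $g\ll f$; $\Omega(g)$ denotes a quantity $\gg g$. *)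

theory Defs
  imports Complex_Main "HOL-Library.Ramsey"
begin

definition simple_graph :: "'a set \<Rightarrow> 'a set set \<Rightarrow> bool" where
  "simple_graph V E \<longleftrightarrow> finite V \<and> E \<subseteq> [V]\<^bsup>2\<^esup>"

(* A copy of K_r is a not necessarily induced subgraph, but for complete graphs
   this is just a set of r pairwise adjacent vertices. *)
definition contains_complete :: "nat \<Rightarrow> 'a set \<Rightarrow> 'a set set \<Rightarrow> bool" where
  "contains_complete r V E \<longleftrightarrow> (\<exists>R \<in> [V]\<^bsup>r\<^esup>. clique R E)"

(* If V has fewer than r vertices, only the complete graph on V is saturated. *)
definition complete_saturated :: "nat \<Rightarrow> 'a set \<Rightarrow> 'a set set \<Rightarrow> bool" where
  "complete_saturated r V E \<longleftrightarrow>
     \<not> contains_complete r V E \<and>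
     (\<forall>f \<in> [V]\<^bsup>2\<^esup> - E. contains_complete r V (insert f E))"

definition vertex_cover :: "'a set \<Rightarrow> 'a set set \<Rightarrow> 'a set \<Rightarrow> bool" where
  "vertex_cover V E C \<longleftrightarrow> C \<subseteq> V \<and> (\<forall>f \<in> E. f \<inter> C \<noteq> {})"

end

theory Submission
  imports Defs
begin

text \<open>
  The core is a triangle-free graph in which any two non-adjacent vertices have a common
  neighbour; \<open>r - 3\<close> universal vertices turn it into a \<open>K\<^sub>r\<close>-saturated graph.
  The vertices \<open>L b A\<close> come in \<open>2\<^sup>k\<close> matched pairs, indexed by the subsets
  \<open>A\<close> of a \<open>k\<close>-element set, which forces every vertex cover to have size at least
  \<open>2\<^sup>k\<close>. There are \<open>2 k\<close> vertices \<open>Z t c\<close>, each standing for a value of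
  the \<open>t\<close>-th bit; \<open>L True A\<close> is joined to the bits of the characteristic vector of
  \<open>A\<close>, and \<open>L False A\<close> to the complementary bits. Matched vertices thus have disjoint
  neighbourhoods, whereas \<open>L True A\<close> and \<open>L False B\<close> with \<open>A \<noteq> B\<close> share a bit,
  all at a cost of only \<open>O(k)\<close> edges per vertex.
  The \<open>N\<close> vertices \<open>U i\<close>, and the \<open>M\<close> vertices \<open>H b j\<close> for each \<open>b\<close>,
  are classes of twins. Their sizes adjust the number of vertices and of edges independently:
  one takes \<open>N \<approx> n\<close>, \<open>M \<approx> e / n\<close> and \<open>2\<^sup>k \<approx> min (e / ln e) n\<close>.
\<close>

section \<open>Saturation of graphs with universal vertices\<close>

definition edges_of :: "'a set \<Rightarrow> ('a \<Rightarrow> 'a \<Rightarrow> bool) \<Rightarrow> 'a set set" where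
  "edges_of V adj = {{a, b} | a b. a \<in> V \<and> b \<in> V \<and> adj a b}"

lemma mem_edges_of:
  assumes "symp adj"
  shows "{a, b} \<in> edges_of V adj \<longleftrightarrow> a \<in> V \<and> b \<in> V \<and> adj a b"
  using assms by (auto simp: edges_of_def doubleton_eq_iff dest: sympD)

lemma simple_graph_edges_of:
  assumes "finite V" "irreflp adj"
  shows "simple_graph V (edges_of V adj)"
  using assms by (auto simp: simple_graph_def edges_of_def nsets_def irreflp_def card_insert_if)

text \<open>An \<open>r\<close>-clique would keep at least three vertices outside \<open>W\<close>,
  hence a triangle there. Conversely, non-adjacent vertices lie outside the universal set
  \<open>W\<close>, and together with \<open>W\<close> and a common neighbour they form an
  \<open>r\<close>-clique once joined.\<close>

lemma complete_saturated_edges_of: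
  assumes fin: "finite V" and sym: "symp adj" and r: "r \<ge> 3"
    and W: "W \<subseteq> V" "card W = r - 3"
    and univ: "\<And>w v. w \<in> W \<Longrightarrow> v \<in> V \<Longrightarrow> w \<noteq> v \<Longrightarrow> adj w v"
    and tri: "\<And>a b c. \<lbrakk>a \<in> V - W; b \<in> V - W; c \<in> V - W; adj a b; adj b c; adj a c\<rbrakk> \<Longrightarrow> False"
    and common: "\<And>a b. \<lbrakk>a \<in> V - W; b \<in> V - W; a \<noteq> b; \<not> adj a b\<rbrakk>
                   \<Longrightarrow> \<exists>c \<in> V - W. c \<noteq> a \<and> c \<noteq> b \<and> adj a c \<and> adj b c"
  shows "complete_saturated r V (edges_of V adj)"
  unfolding complete_saturated_def
proof (intro conjI ballI)
  note mem = mem_edges_of[OF sym]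
  have finW: "finite W" using W(1) fin by (rule finite_subset)
  show "\<not> contains_complete r V (edges_of V adj)"
  proof
    assume "contains_complete r V (edges_of V adj)"
    then obtain R where R: "R \<subseteq> V" "finite R" "card R = r" "clique R (edges_of V adj)"
      by (auto simp: contains_complete_def nsets_def)
    have "card (R - W) \<ge> 3"
      using diff_card_le_card_Diff[OF finW, of R] R W(2) r by linarith
    then obtain T where T: "T \<subseteq> R - W" "card T = 3"
      by (metis obtain_subset_with_card_n)
    then obtain a b c where abc: "T = {a, b, c}" "a \<noteq> b" "b \<noteq> c" "a \<noteq> c"
      by (auto simp: card_3_iff)
    have "{a, b} \<in> edges_of V adj" "{b, c} \<in> edges_of V adj" "{a, c} \<in> edges_of V adj"
      using R(4) T(1) abc by (auto simp: clique_def)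
    then show False
      using tri[of a b c] T(1) abc by (auto simp: mem)
  qed
next
  note mem = mem_edges_of[OF sym]
  have finW: "finite W" using W(1) fin by (rule finite_subset)
  fix f assume f: "f \<in> [V]\<^bsup>2\<^esup> - edges_of V adj"
  then obtain a b where ab: "f = {a, b}" "a \<in> V" "b \<in> V" "a \<noteq> b"
    by (auto simp: nsets_def card_2_iff)
  then have nadj: "\<not> adj a b" using f by (auto simp: mem)
  then have abW: "a \<notin> W" "b \<notin> W"
    using univ ab sym by (metis sympD)+
  then obtain c where c: "c \<in> V - W" "c \<noteq> a" "c \<noteq> b" "adj a c" "adj b c"
    using common[of a b] ab nadj by auto
  let ?R = "insert a (insert b (insert c W))"
  have "card ?R = r"
    using finW W(2) r abW c ab(4) by simp
  moreover have "clique ?R (insert f (edges_of V adj))"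
    unfolding clique_def
  proof (intro ballI impI)
    fix v w assume vw: "v \<in> ?R" "w \<in> ?R" "v \<noteq> w"
    have V: "v \<in> V" "w \<in> V" using vw ab c W(1) by auto
    show "{v, w} \<in> insert f (edges_of V adj)"
    proof (cases "v \<in> W \<or> w \<in> W")
      case True
      then have "adj v w" using univ V vw(3) sympD[OF sym] by metis
      then show ?thesis using V by (simp add: mem)
    next
      case False
      then show ?thesis
        using vw V ab(1) c(4,5) sympD[OF sym] by (auto simp: mem)
    qed
  qed
  ultimately show "contains_complete r V (insert f (edges_of V adj))"
    unfolding contains_complete_def nsets_def
    using ab(2,3) c(1) W(1) finW by (intro bexI[of _ ?R]) auto
qed

section \<open>Transport along injective relabellings\<close>

lemma contains_complete_image:
  assumes inj: "inj_on h V" and E: "E \<subseteq> Pow V"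
  shows "contains_complete r (h ` V) ((`) h ` E) \<longleftrightarrow> contains_complete r V E"
proof -
  have injim: "inj_on ((`) h) (Pow V)" using inj by (rule inj_on_image_Pow)
  have clique: "clique (h ` R) ((`) h ` E) \<longleftrightarrow> clique R E" if "R \<subseteq> V" for R
  proof -
    have "h ` {v, w} \<in> (`) h ` E \<longleftrightarrow> {v, w} \<in> E" if "v \<in> R" "w \<in> R" for v w
      using inj_on_image_mem_iff[OF injim, of "{v, w}" E] E that \<open>R \<subseteq> V\<close> by auto
    moreover have "h v = h w \<longleftrightarrow> v = w" if "v \<in> R" "w \<in> R" for v w
      using inj that \<open>R \<subseteq> V\<close> by (auto simp: inj_on_def)
    ultimately show ?thesis by (auto simp: clique_def)
  qed
  have card: "card (h ` R) = card R" if "R \<subseteq> V" for R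
    using that inj by (meson card_image inj_on_subset)
  have fin: "finite (h ` R) \<longleftrightarrow> finite R" if "R \<subseteq> V" for R
    using that inj by (meson finite_image_iff inj_on_subset)
  have "contains_complete r (h ` V) ((`) h ` E) \<longleftrightarrow>
      (\<exists>R\<subseteq>V. finite (h ` R) \<and> card (h ` R) = r \<and> clique (h ` R) ((`) h ` E))"
    unfolding contains_complete_def nsets_def by (auto simp: subset_image_iff)
  also have "\<dots> \<longleftrightarrow> contains_complete r V E"
    unfolding contains_complete_def nsets_def using clique card fin by auto
  finally show ?thesis .
qed

lemma complete_saturated_image:
  assumes inj: "inj_on h V" and E: "E \<subseteq> Pow V" and sat: "complete_saturated r V E"
  shows "complete_saturated r (h ` V) ((`) h ` E)"
  unfolding complete_saturated_def
proof (intro conjI ballI)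
  show "\<not> contains_complete r (h ` V) ((`) h ` E)"
    using sat contains_complete_image[OF inj E] by (simp add: complete_saturated_def)
next
  fix f assume f: "f \<in> [h ` V]\<^bsup>2\<^esup> - (`) h ` E"
  then obtain g where g: "g \<subseteq> V" "f = h ` g"
    by (auto simp: nsets_def subset_image_iff)
  have "inj_on h g" using inj g(1) by (rule inj_on_subset)
  then have "g \<in> [V]\<^bsup>2\<^esup> - E"
    using f g by (auto simp: nsets_def card_image finite_image_iff)
  then have "contains_complete r V (insert g E)"
    using sat by (auto simp: complete_saturated_def)
  then have "contains_complete r (h ` V) ((`) h ` insert g E)"
    using contains_complete_image[OF inj, of "insert g E"] E g(1) by auto
  then show "contains_complete r (h ` V) (insert f ((`) h ` E))"
    using g(2) by simp
qed

text \<open>Covers are pulled back, so a lower bound on cover sizes survives the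
  relabelling.\<close>

lemma vertex_cover_image:
  assumes inj: "inj_on h V" and E: "E \<subseteq> Pow V"
    and C: "vertex_cover (h ` V) ((`) h ` E) C"
  obtains D where "vertex_cover V E D" "card D = card C"
proof -
  obtain D where D: "D \<subseteq> V" "C = h ` D"
    using C by (auto simp: vertex_cover_def subset_image_iff)
  have "g \<inter> D \<noteq> {}" if "g \<in> E" for g
  proof -
    have "h ` g \<inter> h ` D \<noteq> {}" using C D(2) that by (auto simp: vertex_cover_def)
    moreover have "g \<subseteq> V" using that E by auto
    ultimately show ?thesis using inj D(1) by (metis image_empty inj_on_image_Int)
  qed
  moreover have "card D = card C"
    using D inj by (metis card_image inj_on_subset)
  ultimately show thesis using that[of D] D(1) by (simp add: vertex_cover_def)
qed

section \<open>The construction and its saturation\<close>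

datatype vertex =
  W nat | U nat | S | H bool nat | Z nat bool | L bool "nat set"

text \<open>Apart from \<open>W\<close>-\<open>W\<close> and \<open>L\<close>-\<open>L\<close>, each
  pair of vertex types that can be adjacent is listed in one order only; \<open>adj\<close>
  symmetrises. This orientation also serves to count edges by products of classes.\<close>

fun arc :: "vertex \<Rightarrow> vertex \<Rightarrow> bool" where
  "arc (W i) v = (v \<noteq> W i)"
| "arc (U i) S = True"
| "arc (U i) (H b j) = True"
| "arc S (Z t c) = True"
| "arc (L b A) (H b' j) = (b = b')"
| "arc (L b A) (Z t c) = (b = ((t \<in> A) = c))"
| "arc (L b A) (L b' B) = (b \<noteq> b' \<and> A = B)"
| "arc _ _ = False"

definition adj :: "vertex \<Rightarrow> vertex \<Rightarrow> bool" where
  "adj v w \<longleftrightarrow> arc v w \<or> arc w v"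

lemma symp_adj: "symp adj"
  by (auto simp: symp_def adj_def)

lemma irreflp_adj: "irreflp adj"
proof (rule irreflpI)
  show "\<not> adj v v" for v by (cases v) (auto simp: adj_def)
qed

definition core :: "nat \<Rightarrow> nat \<Rightarrow> nat \<Rightarrow> vertex set" where
  "core N M k = U ` {..<N} \<union> {S} \<union> case_prod H ` (UNIV \<times> {..<M})
     \<union> case_prod Z ` ({..<k} \<times> UNIV) \<union> case_prod L ` (UNIV \<times> Pow {..<k})"

definition verts :: "nat \<Rightarrow> nat \<Rightarrow> nat \<Rightarrow> nat \<Rightarrow> vertex set" where
  "verts q N M k = W ` {..<q} \<union> core N M k"

lemma core_simps:
  "W i \<notin> core N M k"
  "U i \<in> core N M k \<longleftrightarrow> i < N"
  "S \<in> core N M k"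
  "H b j \<in> core N M k \<longleftrightarrow> j < M"
  "Z t c \<in> core N M k \<longleftrightarrow> t < k"
  "L b A \<in> core N M k \<longleftrightarrow> A \<subseteq> {..<k}"
  by (auto simp: core_def image_iff)

text \<open>On types, adjacency is the 5-cycle \<open>U\<close>, \<open>S\<close>, \<open>Z\<close>,
  \<open>L\<close>, \<open>H\<close> with a loop at \<open>L\<close>. A triangle must therefore use
  the loop, that is, contain a matched pair \<open>L True A\<close>, \<open>L False A\<close>; but
  such a pair has no common neighbour.\<close>

lemma core_triangle_free:
  assumes "a \<in> core N M k" "b \<in> core N M k" "c \<in> core N M k" "adj a b" "adj b c" "adj a c"
  shows False
  using assms
  by (cases a; cases b; cases c) (auto simp: core_simps adj_def)

lemma core_common_neighbour:
  assumes pos: "N > 0" "M > 0" "k > 0"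
    and ab: "a \<in> core N M k" "b \<in> core N M k" "a \<noteq> b" "\<not> adj a b"
  shows "\<exists>c \<in> core N M k. adj a c \<and> adj b c"
proof -
  \<comment> \<open>Since \<open>P\<close> is symmetric, each unordered pair of types needs only one
    explicit common neighbour.\<close>
  define P where "P v w \<longleftrightarrow> (\<exists>c \<in> core N M k. adj v c \<and> adj w c)" for v w
  have P_sym: "P w v" if "P v w" for v w
    using that by (auto simp: P_def)
  have PI: "P v w" if "c \<in> core N M k" "adj v c" "adj w c" for v w c
    using that by (auto simp: P_def)
  note simps = core_simps adj_def
  have UU: "P (U i) (U j)" for i j
    by (rule PI[of "H True 0"]) (use pos in \<open>auto simp: simps\<close>)
  have UZ: "P (U i) (Z t c)" for i t c
    by (rule PI[of S]) (auto simp: simps)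
  have UL: "P (U i) (L b A)" for i b A
    by (rule PI[of "H b 0"]) (use pos in \<open>auto simp: simps\<close>)
  have SH: "P S (H b j)" for b j
    by (rule PI[of "U 0"]) (use pos in \<open>auto simp: simps\<close>)
  \<comment> \<open>The witness is the value of bit 0 to which \<open>L b A\<close> is joined; it
    exists because \<open>k > 0\<close>.\<close>
  have SL: "P S (L b A)" for b A
    by (rule PI[of "Z 0 ((0 \<in> A) = b)"]) (use pos in \<open>auto simp: simps\<close>)
  have HH: "P (H b i) (H c j)" for b c i j
    by (rule PI[of "U 0"]) (use pos in \<open>auto simp: simps\<close>)
  \<comment> \<open>The set \<open>{t}\<close> or \<open>{}\<close> is chosen so that
    \<open>L b\<close> of it is joined to \<open>Z t c\<close>.\<close>
  have HZ: "P (H b j) (Z t c)" if "t < k" for b j t c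
    by (rule PI[of "L b (if b = c then {t} else {})"]) (use that in \<open>auto simp: simps\<close>)
  \<comment> \<open>Here, and for \<open>ZL\<close> below, the matched partner of the
    \<open>L\<close> vertex works: it sees exactly the \<open>H\<close> and \<open>Z\<close>
    vertices that the \<open>L\<close> vertex misses.\<close>
  have HL: "P (H b j) (L c A)" if "b \<noteq> c" "A \<subseteq> {..<k}" for b j c A
    by (rule PI[of "L b A"]) (use that in \<open>auto simp: simps\<close>)
  have ZZ: "P (Z t c) (Z u d)" for t c u d
    by (rule PI[of S]) (auto simp: simps)
  have ZL: "P (Z t c) (L b A)" if "b \<noteq> ((t \<in> A) = c)" "A \<subseteq> {..<k}" for t c b A
    by (rule PI[of "L (\<not> b) A"]) (use that in \<open>auto simp: simps\<close>)
  have LL: "P (L b A) (L c B)"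
    if AB: "A \<subseteq> {..<k}" "B \<subseteq> {..<k}" "b = c \<or> A \<noteq> B" for b c A B
  proof (cases "b = c")
    case True
    show ?thesis
      by (rule PI[of "H b 0"]) (use pos True in \<open>auto simp: simps\<close>)
  next
    case False
    then have "A \<noteq> B" using AB(3) by simp
    \<comment> \<open>With \<open>b \<noteq> c\<close>, the two vertices are joined to the same
      value of bit \<open>t\<close> exactly when \<open>A\<close> and \<open>B\<close> differ at
      \<open>t\<close>.\<close>
    then obtain t where "t < k" "(t \<in> A) \<noteq> (t \<in> B)" using AB(1,2) by blast
    then show ?thesis
      by (intro PI[of "Z t ((t \<in> A) = b)"]) (use False in \<open>auto simp: simps\<close>)
  qed
  note pairs = UU UZ UL SH SL HH HZ HL ZZ ZL LL
  have "P a b"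
    using ab by (cases a; cases b) (auto simp: simps pairs pairs[THEN P_sym])
  then show ?thesis by (simp add: P_def)
qed

lemma finite_core: "finite (core N M k)"
  by (auto simp: core_def)

lemma verts_diff_W: "verts q N M k - W ` {..<q} = core N M k"
  by (auto simp: verts_def core_simps)


section \<open>Cover size and counts of vertices and edges\<close>

text \<open>The edges between \<open>L True A\<close> and \<open>L False A\<close> form a matching
  of size \<open>2 ^ k\<close>, and a cover meets each of them.\<close>

lemma card_cover_verts:
  assumes "vertex_cover (verts q N M k) (edges_of (verts q N M k) adj) C"
  shows "2 ^ k \<le> card C"
proof -
  \<comment> \<open>The default \<open>{}\<close> is harmless: only surjectivity of
    \<open>index\<close> from \<open>C\<close> onto the subsets matters.\<close>
  define index where "index v = (case v of L b A \<Rightarrow> A | _ \<Rightarrow> {})" for v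
  have "A \<in> index ` C" if "A \<subseteq> {..<k}" for A
  proof -
    have "{L True A, L False A} \<in> edges_of (verts q N M k) adj"
      using that by (auto simp: mem_edges_of[OF symp_adj] verts_def core_simps adj_def)
    then have "{L True A, L False A} \<inter> C \<noteq> {}"
      using assms by (auto simp: vertex_cover_def)
    then obtain b where "L b A \<in> C" by auto
    then show ?thesis by (force simp: index_def)
  qed
  then have "Pow {..<k} \<subseteq> index ` C" by auto
  moreover have finC: "finite C"
    using assms finite_core by (auto simp: vertex_cover_def verts_def intro: finite_subset)
  ultimately have "card (Pow {..<k}) \<le> card C"
    by (meson card_image_le card_mono finite_imageI le_trans)
  then show ?thesis by (simp add: card_Pow)
qed

lemma card_Un_le_add: "card A \<le> a \<Longrightarrow> card B \<le> b \<Longrightarrow> card (A \<union> B) \<le> a + b"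
  using card_Un_le[of A B] by linarith

lemma card_image_le_eq: "finite A \<Longrightarrow> card A = c \<Longrightarrow> card (f ` A) \<le> c"
  using card_image_le by auto

lemma card_verts_ge: "N \<le> card (verts q N M k)"
proof -
  have "card (U ` {..<N}) \<le> card (verts q N M k)"
    using finite_core by (intro card_mono) (auto simp: verts_def core_def)
  then show ?thesis by (simp add: card_image inj_on_def)
qed

lemma card_verts_le:
  "card (verts q N M k) \<le> q + (N + 1 + 2 * M + 2 * k + 2 * 2 ^ k)"
  unfolding verts_def core_def
  by (intro card_Un_le_add card_image_le_eq) (auto simp: card_cartesian_product card_Pow)

lemma card_edges_ge: "N * M \<le> card (edges_of (verts q N M k) adj)"
proof -
  let ?f = "\<lambda>(i, j). {U i, H True j}"
  have "finite (edges_of (verts q N M k) adj)"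
    by (rule finite_subset[of _ "Pow (verts q N M k)"])
       (auto simp: edges_of_def verts_def finite_core)
  moreover have "?f ` ({..<N} \<times> {..<M}) \<subseteq> edges_of (verts q N M k) adj"
    by (auto simp: mem_edges_of[OF symp_adj] verts_def core_simps adj_def)
  ultimately have "card (?f ` ({..<N} \<times> {..<M})) \<le> card (edges_of (verts q N M k) adj)"
    by (rule card_mono)
  moreover have "inj_on ?f ({..<N} \<times> {..<M})"
    by (auto simp: inj_on_def doubleton_eq_iff)
  ultimately show ?thesis by (simp add: card_image card_cartesian_product)
qed

text \<open>Edges are images of pairs from products of vertex classes, following the orientation of
  \<open>arc\<close>. The matching is counted separately by its index set, because
  \<open>Ls \<times> Ls\<close> would contribute order \<open>4 ^ k\<close>.\<close>

lemma card_edges_le: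
  "card (edges_of (verts q N M k) adj)
     \<le> q * card (verts q N M k) + (2 * N * M + N + 2 * k + 4 * 2 ^ k * M + 4 * 2 ^ k * k + 2 ^ k)"
proof -
  define p :: "vertex \<times> vertex \<Rightarrow> vertex set" where "p = (\<lambda>(v, w). {v, w})"
  define Us where "Us = U ` {..<N}"
  define Hs where "Hs = case_prod H ` (UNIV \<times> {..<M})"
  define Zs where "Zs = case_prod Z ` ({..<k} \<times> UNIV)"
  define Ls where "Ls = case_prod L ` (UNIV \<times> Pow {..<k})"
  note defs = Us_def Hs_def Zs_def Ls_def
  have mem: "v \<in> Us \<longleftrightarrow> (\<exists>i<N. v = U i)" "v \<in> Hs \<longleftrightarrow> (\<exists>b. \<exists>j<M. v = H b j)"
    "v \<in> Zs \<longleftrightarrow> (\<exists>t<k. \<exists>c. v = Z t c)" "v \<in> Ls \<longleftrightarrow> (\<exists>b. \<exists>A\<subseteq>{..<k}. v = L b A)" for v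
    unfolding defs by auto
  let ?V = "verts q N M k"
  define X where "X = W ` {..<q} \<times> ?V \<union>
    (Us \<times> Hs \<union> Us \<times> {S} \<union> {S} \<times> Zs \<union> Ls \<times> Hs \<union> Ls \<times> Zs)"
  define T where "T = p ` X \<union> (\<lambda>A. {L True A, L False A}) ` Pow {..<k}"
  have arc: "{v, w} \<in> T" if "v \<in> ?V" "w \<in> ?V" "arc v w" for v w
  proof (cases "\<exists>A B b c. v = L b A \<and> w = L c B")
    case True
    then obtain b c A B where L: "v = L b A" "w = L c B" by blast
    then have "b \<noteq> c" "A = B" and A: "A \<subseteq> {..<k}"
      using that by (auto simp: verts_def core_simps)
    then have "{v, w} = {L True A, L False A}" using L by (cases b) auto
    then show ?thesis using A by (simp add: T_def)
  next
    case False
    have "(v, w) \<in> X"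
      using that False unfolding X_def Un_iff mem_Times_iff
      by (cases v; cases w) (auto simp: verts_def core_simps mem)
    then have "p (v, w) \<in> T" unfolding T_def by blast
    then show ?thesis by (simp add: p_def)
  qed
  have "edges_of ?V adj \<subseteq> T"
  proof
    fix f assume "f \<in> edges_of ?V adj"
    then obtain v w where "f = {v, w}" "v \<in> ?V" "w \<in> ?V" "arc v w \<or> arc w v"
      by (auto simp: edges_of_def adj_def)
    then show "f \<in> T" using arc[of v w] arc[of w v] by (metis insert_commute)
  qed
  moreover have finV: "finite ?V" by (simp add: verts_def finite_core)
  have fin: "finite Us" "finite Hs" "finite Zs" "finite Ls"
    by (auto simp: defs)
  have cards: "card Us = N" "card Hs = 2 * M" "card Zs = 2 * k" "card Ls = 2 * 2 ^ k"
    "card (W ` {..<q}) = q"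
    unfolding defs
    by (subst card_image; auto simp: inj_on_def card_cartesian_product card_Pow)+
  have "card X \<le> q * card ?V + (N * (2 * M) + N * 1 + 1 * (2 * k) + 2 * 2 ^ k * (2 * M)
      + 2 * 2 ^ k * (2 * k))"
    unfolding X_def
    by (intro card_Un_le_add) (simp_all add: cards card_cartesian_product)
  moreover have finX: "finite X" using fin finV by (simp add: X_def)
  moreover have "card T \<le> card X + 2 ^ k"
    unfolding T_def using finX
    by (intro card_Un_le_add card_image_le card_image_le_eq) (simp_all add: card_Pow)
  moreover have "finite T" using finX by (simp add: T_def)
  ultimately show ?thesis
    using card_mono[of T "edges_of ?V adj"] by (simp add: algebra_simps)
qed

section \<open>Assembly over the natural numbers\<close>

lemma complete_saturated_verts:
  assumes "r \<ge> 3" "N > 0" "M > 0" "k > 0"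
  shows "complete_saturated r (verts (r - 3) N M k) (edges_of (verts (r - 3) N M k) adj)"
proof (rule complete_saturated_edges_of[where W = "W ` {..<r - 3}"])
  show "\<exists>c\<in>verts (r - 3) N M k - W ` {..<r - 3}. c \<noteq> a \<and> c \<noteq> b \<and> adj a c \<and> adj b c"
    if "a \<in> verts (r - 3) N M k - W ` {..<r - 3}" "b \<in> verts (r - 3) N M k - W ` {..<r - 3}"
      "a \<noteq> b" "\<not> adj a b" for a b
    using core_common_neighbour[OF assms(2-4)] that irreflp_adj
    unfolding verts_diff_W by (metis irreflpD)
  show False if "a \<in> verts (r - 3) N M k - W ` {..<r - 3}" "b \<in> verts (r - 3) N M k - W ` {..<r - 3}"
      "c \<in> verts (r - 3) N M k - W ` {..<r - 3}" "adj a b" "adj b c" "adj a c" for a b c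
    using core_triangle_free that unfolding verts_diff_W by blast
qed (use assms in \<open>auto simp: verts_def finite_core symp_adj adj_def card_image inj_on_def\<close>)

lemma exists_saturated_nat_graph:
  assumes "r \<ge> 3" "N > 0" "M > 0" "k > 0"
  obtains V :: "nat set" and E where
    "simple_graph V E" "complete_saturated r V E"
    "N \<le> card V" "card V \<le> r + (N + 1 + 2 * M + 2 * k + 2 * 2 ^ k)"
    "N * M \<le> card E"
    "card E \<le> r * card V + (2 * N * M + N + 2 * k + 4 * 2 ^ k * M + 4 * 2 ^ k * k + 2 ^ k)"
    "\<And>C. vertex_cover V E C \<Longrightarrow> 2 ^ k \<le> card C"
proof -
  let ?V = "verts (r - 3) N M k"
  let ?E = "edges_of ?V adj"
  have fin: "finite ?V" by (simp add: verts_def finite_core)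
  obtain h :: "vertex \<Rightarrow> nat" where inj: "inj_on h ?V"
    using finite_imp_inj_to_nat_seg[OF fin] by metis
  have E: "?E \<subseteq> Pow ?V" by (auto simp: edges_of_def)
  have cardV: "card (h ` ?V) = card ?V" by (rule card_image[OF inj])
  have cardE: "card ((`) h ` ?E) = card ?E"
    using inj_on_subset[OF inj_on_image_Pow[OF inj] E] by (rule card_image)
  show thesis
  proof (rule that[of "h ` ?V" "(`) h ` ?E"])
    have simple: "simple_graph ?V ?E"
      using fin irreflp_adj by (rule simple_graph_edges_of)
    have "h ` f \<in> [h ` ?V]\<^bsup>2\<^esup>" if "f \<in> ?E" for f
      using simple that inj_on_subset[OF inj, of f]
      by (auto simp: simple_graph_def nsets_def card_image)
    then show "simple_graph (h ` ?V) ((`) h ` ?E)"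
      using fin by (auto simp: simple_graph_def)
    show "complete_saturated r (h ` ?V) ((`) h ` ?E)"
      using inj E complete_saturated_verts[OF assms] by (rule complete_saturated_image)
    show "N \<le> card (h ` ?V)"
      unfolding cardV by (rule card_verts_ge)
    show "card (h ` ?V) \<le> r + (N + 1 + 2 * M + 2 * k + 2 * 2 ^ k)"
      unfolding cardV using card_verts_le[of "r - 3" N M k] by linarith
    show "N * M \<le> card ((`) h ` ?E)"
      unfolding cardE by (rule card_edges_ge)
    show "card ((`) h ` ?E) \<le> r * card (h ` ?V) +
        (2 * N * M + N + 2 * k + 4 * 2 ^ k * M + 4 * 2 ^ k * k + 2 ^ k)"
      unfolding cardE cardV
      by (rule order.trans[OF card_edges_le]) (intro add_mono mult_mono, auto)
    show "2 ^ k \<le> card C" if "vertex_cover (h ` ?V) ((`) h ` ?E) C" for C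
      using vertex_cover_image[OF inj E that] card_cover_verts by metis
  qed
qed

section \<open>Choice of parameters and asymptotic bounds\<close>

theorem theorem5:
  shows "\<forall>a1 a2 :: real. a1 > 0 \<and> a2 > 0 \<longrightarrow>
    (\<exists>N0 b1 b2 b3 b4 b5 :: real.
       N0 > 0 \<and> b1 > 0 \<and> b2 > 0 \<and> b3 > 0 \<and> b4 > 0 \<and> b5 > 0 \<and>
       (\<forall>(r :: nat) (n :: real) (e :: real).
          r \<ge> 3 \<and> n \<ge> N0 \<and> e \<ge> N0 \<and> a1 * real r * n \<le> e \<and> e \<le> a2 * n\<^sup>2 \<longrightarrow>
          (\<exists>(V :: nat set) (E :: nat set set).
             simple_graph V E \<and> complete_saturated r V E \<and>
             b1 * n \<le> real (card V) \<and> real (card V) \<le> b2 * n \<and>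
             b3 * e \<le> real (card E) \<and> real (card E) \<le> b4 * e \<and>
             (\<forall>C. vertex_cover V E C \<longrightarrow>
                real (card C) \<ge> b5 * min (e / ln e) n))))"
proof (intro allI impI, elim conjE)
  fix a1 a2 :: real
  assume a: "a1 > 0" "a2 > 0"
  \<comment> \<open>The summands of \<open>b2\<close> bound, as multiples of \<open>n\<close>, the
    \<open>r\<close> universal vertices, the \<open>2 * M\<close> vertices \<open>H\<close>, and
    everything else.\<close>
  define b2 where "b2 = a2 / a1 + 2 * a2 + 9"
  \<comment> \<open>\<open>b2 / a1\<close> pays for edges at universal vertices. The 20 is 12 from
    \<open>6 * (N * M)\<close> plus 8 from \<open>4 * 2 ^ k * k\<close>; the 17 collects the terms
    linear in \<open>n\<close>, using \<open>n \<le> e / a1\<close>.\<close>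
  define b4 where "b4 = b2 / a1 + 20 + 17 / a1"
  have "b2 > 0" using a by (simp add: b2_def add_pos_pos)
  then have b: "b2 > 0" "b4 > 0" using a by (auto simp: b4_def intro!: add_pos_pos)
  have main: "\<exists>(V :: nat set) (E :: nat set set).
             simple_graph V E \<and> complete_saturated r V E \<and>
             1 * n \<le> real (card V) \<and> real (card V) \<le> b2 * n \<and>
             1 * e \<le> real (card E) \<and> real (card E) \<le> b4 * e \<and>
             (\<forall>C. vertex_cover V E C \<longrightarrow> real (card C) \<ge> 1/2 * min (e / ln e) n)"
    if r: "r \<ge> 3" and n: "n \<ge> 3" and e: "e \<ge> 3" and le: "a1 * real r * n \<le> e"
      and eu: "e \<le> a2 * n\<^sup>2" for r :: nat and n e :: real
  proof -
    define m where "m = min (e / ln e) n"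
    define k where "k = nat \<lfloor>log 2 m\<rfloor>"
    define N where "N = nat \<lceil>n\<rceil>"
    define M where "M = nat \<lceil>e / n\<rceil>"
    \<comment> \<open>Applying \<open>ln x \<le> x - 1\<close> at \<open>e / 2\<close> gives
      \<open>e / ln e \<ge> 2\<close>, which ensures \<open>m \<ge> 2\<close> and thus
      \<open>k > 0\<close>.\<close>
    have "ln (e / 2) \<le> e / 2 - 1" using e by (intro ln_le_minus_one) auto
    moreover have "ln (2::real) \<le> 1" using ln_le_minus_one[of 2] by simp
    ultimately have ln2e: "2 * ln e \<le> e" using e by (simp add: ln_div)
    have lne: "ln e \<ge> 1"
      using e exp_le by (simp add: ln_ge_iff)
    have m: "m \<ge> 2" using ln2e lne n by (simp add: m_def le_divide_eq)
    have mn: "m \<le> n" by (simp add: m_def)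
    have "m \<le> e / ln e" by (simp add: m_def)
    then have mlne: "m * ln e \<le> e" using lne by (simp add: le_divide_eq)
    have "m * 1 \<le> m * ln e" using lne m by (intro mult_left_mono) auto
    then have me: "m \<le> e" using mlne by simp
    have log1: "log 2 m \<ge> 1" using m by (simp add: le_log_iff)
    have k0: "k > 0" using log1 by (simp add: k_def)
    have k1: "real k \<le> log 2 m" using log1 by (simp add: k_def)
    have k2: "log 2 m < real k + 1" using log1 unfolding k_def by linarith
    have pow_le: "2 ^ k \<le> m"
      using k1 m by (simp add: le_log_iff powr_realpow)
    \<comment> \<open>Rounding the logarithm down loses a factor below 2, whence the constant
      \<open>1/2\<close> for covers.\<close>
    have pow_gt: "m < 2 * 2 ^ k"
    proof -
      have "m < 2 powr (real k + 1)" using k2 m by (simp add: log_less_iff)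
      also have "\<dots> = 2 * 2 ^ k" by (simp add: powr_add powr_realpow)
      finally show ?thesis .
    qed
    have lnhalf: "ln (2::real) \<ge> 1/2"
      using ln_le_minus_one[of "1/2"] by (simp add: ln_div)
    have "real k * (1/2) \<le> real k * ln 2" by (rule mult_left_mono[OF lnhalf]) simp
    also have "real k * ln 2 \<le> ln m" using k1 by (simp add: log_def le_divide_eq)
    also have "\<dots> \<le> ln e" using me m by simp
    finally have kln: "real k \<le> 2 * ln e" by simp
    \<comment> \<open>This is where the bound \<open>e / ln e\<close> on \<open>m\<close> is needed:
      it keeps the number of \<open>L\<close>-\<open>Z\<close> edges of order
      \<open>e\<close>.\<close>
    have "2 ^ k * real k \<le> m * (2 * ln e)"
      using pow_le kln m by (intro mult_mono) auto
    then have kpow: "2 ^ k * real k \<le> 2 * e" using mlne by linarith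
    have N: "n \<le> real N" "real N \<le> 2 * n" using n unfolding N_def by linarith+
    have en: "e / n > 0" using e n by simp
    have M: "e / n \<le> real M" "real M \<le> e / n + 1" using en unfolding M_def by linarith+
    have M0: "M > 0" using en unfolding M_def by linarith
    have N0: "N > 0" using N n by linarith
    have "1 * (a1 * n) \<le> real r * (a1 * n)" using r a n by (intro mult_right_mono) auto
    then have "a1 * n \<le> e" using le by (simp add: mult_ac)
    then have nle: "n \<le> e / a1" using a by (simp add: field_simps)
    have NMu: "real N * real M \<le> 2 * e + 2 * n"
    proof -
      have "real N * real M \<le> (2 * n) * (e / n + 1)"
        using N M n by (intro mult_mono) auto
      also have "\<dots> = 2 * e + 2 * n" using n by (simp add: field_simps)
      finally show ?thesis .
    qed
    have NMl: "e \<le> real N * real M"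
    proof -
      have "n * (e / n) \<le> real N * real M"
        using N M n e by (intro mult_mono) auto
      then show ?thesis using n by simp
    qed
    \<comment> \<open>Comparing the lower and upper bounds on \<open>e\<close> shows that
      \<open>r\<close> is at most of order \<open>n\<close>.\<close>
    have "a1 * real r * n \<le> a2 * n * n"
      using le eu by (simp add: power2_eq_square mult.assoc)
    then have "a1 * real r \<le> a2 * n" using n by simp
    then have rle: "real r \<le> a2 / a1 * n" using a by (simp add: field_simps)
    have "e / n \<le> a2 * n" using eu n by (simp add: divide_le_eq power2_eq_square mult.assoc)
    then have Mn: "real M \<le> a2 * n + 1" using M by linarith
    have kpow': "real k \<le> 2 ^ k" by (metis less_exp less_imp_le of_nat_le_iff of_nat_numeral of_nat_power)
    obtain V :: "nat set" and E where G: "simple_graph V E" "complete_saturated r V E"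
      "N \<le> card V" "card V \<le> r + (N + 1 + 2 * M + 2 * k + 2 * 2 ^ k)" "N * M \<le> card E"
      "card E \<le> r * card V + (2 * N * M + N + 2 * k + 4 * 2 ^ k * M + 4 * 2 ^ k * k + 2 ^ k)"
      "\<And>C. vertex_cover V E C \<Longrightarrow> 2 ^ k \<le> card C"
      using exists_saturated_nat_graph[OF r N0 M0 k0] by metis
    have "real (card V) \<le> real (r + (N + 1 + 2 * M + 2 * k + 2 * 2 ^ k))"
      using G(4) by (rule of_nat_mono)
    then have "real (card V) \<le> real r + real N + 1 + 2 * real M + 2 * real k + 2 * 2 ^ k"
      by simp
    also have "\<dots> \<le> a2 / a1 * n + 2 * (a2 * n) + 9 * n"
    proof -
      \<comment> \<open>Products and powers are abstracted to variables, leaving a purely linear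
        inequality.\<close>
      have "R + N' + 1 + 2 * M' + 2 * K + 2 * P \<le> x + 2 * y + 9 * n"
        if "R \<le> x" "N' \<le> 2 * n" "M' \<le> y + 1" "K \<le> P" "P \<le> m" for R N' M' K P x y :: real
        using that mn n by linarith
      from this[OF rle N(2) Mn kpow' pow_le] show ?thesis .
    qed
    also have "\<dots> = b2 * n" by (simp add: b2_def algebra_simps)
    finally have Vu: "real (card V) \<le> b2 * n" .
    have "real r * real (card V) \<le> real r * (b2 * n)"
      by (rule mult_left_mono[OF Vu]) simp
    also have "\<dots> = b2 / a1 * (a1 * real r * n)" using a by simp
    also have "\<dots> \<le> b2 / a1 * e" using le b a by (intro mult_left_mono) auto
    finally have rV: "real r * real (card V) \<le> b2 / a1 * e" .
    \<comment> \<open>This is where the bound \<open>n\<close> on \<open>m\<close> is needed: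
      \<open>2 ^ k \<le> N\<close>, so the \<open>L\<close>-\<open>H\<close> edges are dominated by
      the \<open>U\<close>-\<open>H\<close> edges up to a constant.\<close>
    have powM: "2 ^ k * real M \<le> real N * real M"
      using order_trans[OF pow_le order_trans[OF mn N(1)]] by (rule mult_right_mono) simp
    have "real (card E) \<le> real (r * card V + (2 * N * M + N + 2 * k + 4 * 2 ^ k * M + 4 * 2 ^ k * k + 2 ^ k))"
      using G(6) by (rule of_nat_mono)
    then have "real (card E) \<le> real r * real (card V) + 2 * (real N * real M) + real N + 2 * real k
        + 4 * (2 ^ k * real M) + 4 * (2 ^ k * real k) + 2 ^ k"
      by (simp add: mult.assoc)
    also have "\<dots> \<le> b2 / a1 * e + 20 * e + 17 * (e / a1)"
    proof -
      have "x + 2 * NM + N' + 2 * K + 4 * PM + 4 * PK + P \<le> x' + 20 * e + 17 * y"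
        if "x \<le> x'" "NM \<le> 2 * e + 2 * n" "PM \<le> NM" "N' \<le> 2 * n" "K \<le> P" "P \<le> m"
          "PK \<le> 2 * e" "n \<le> y" for x x' NM N' K PM PK P y :: real
        using that mn by linarith
      from this[OF rV NMu powM N(2) kpow' pow_le kpow nle] show ?thesis .
    qed
    also have "\<dots> = b4 * e" by (simp add: b4_def algebra_simps)
    finally have Eu: "real (card E) \<le> b4 * e" .
    have El: "e \<le> real (card E)"
      using NMl G(5) by (metis of_nat_le_iff of_nat_mult order_trans)
    have Vl: "n \<le> real (card V)" using N(1) G(3) by linarith
    have cover: "1/2 * min (e / ln e) n \<le> real (card C)" if "vertex_cover V E C" for C
    proof -
      have "real (2 ^ k) \<le> real (card C)" using G(7)[OF that] by (rule of_nat_mono)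
      then have "2 ^ k \<le> real (card C)" by (simp only: of_nat_power of_nat_numeral)
      then have "1/2 * m \<le> real (card C)" using pow_gt by linarith
      then show ?thesis by (simp only: m_def)
    qed
    show ?thesis
      using G(1,2) Vl Vu El Eu cover by (intro exI[of _ V] exI[of _ E]) simp
  qed
  show "\<exists>N0 b1 b2 b3 b4 b5 :: real.
       N0 > 0 \<and> b1 > 0 \<and> b2 > 0 \<and> b3 > 0 \<and> b4 > 0 \<and> b5 > 0 \<and>
       (\<forall>(r :: nat) (n :: real) (e :: real).
          r \<ge> 3 \<and> n \<ge> N0 \<and> e \<ge> N0 \<and> a1 * real r * n \<le> e \<and> e \<le> a2 * n\<^sup>2 \<longrightarrow>
          (\<exists>(V :: nat set) (E :: nat set set).
             simple_graph V E \<and> complete_saturated r V E \<and>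
             b1 * n \<le> real (card V) \<and> real (card V) \<le> b2 * n \<and>
             b3 * e \<le> real (card E) \<and> real (card E) \<le> b4 * e \<and>
             (\<forall>C. vertex_cover V E C \<longrightarrow>
                real (card C) \<ge> b5 * min (e / ln e) n)))"
    by (rule exI[of _ 3], rule exI[of _ 1], rule exI[of _ b2], rule exI[of _ 1],
        rule exI[of _ b4], rule exI[of _ "1/2"]) (use b main in auto)
qed

end
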